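(* Let $u\ge \ell\ge 1$ and $m\ge 1$ be integers with $m\le 2^u$, let $n\coloneqq 2^\ell$, and let $\mathcal{H}$ be the set of all linear maps $\mathbb{F}_2^u\to\mathbb{F}_2^\ell$. For any $S\subseteq \mathbb{F}_2^u$ of cardinality $m$, if $h$ is drawn uniformly at random from $\mathcal{H}$, then \[\mathbb{E}_{h\sim \mathcal{H}}\left[\max_{y\in \mathbb{F}_2^\ell} |h^{-1}(y)\cap S|\right] \le 16\cdot \textsc{opt}(m,n).\]
   Context: $\log$ denotes the base-2 logarithm. For positive integers $m,n$ define \[\textsc{opt}(m,n) = \begin{cases}\dfrac{\log n}{\log\left(\frac{n\log n}{m}\right)} & m\le \frac{1}{2}n\log n, \\[2mm] \dfrac{m}{n} & m > \frac{1}{2} n\log n.\end{cases}\] *)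

theory Defs
  imports "HOL-Probability.Probability" "HOL-Library.Z2"
begin

definition opt :: "nat \<Rightarrow> nat \<Rightarrow> real" where
  "opt m n =
    (if real m \<le> 1 / 2 * real n * log 2 (real n)
     then log 2 (real n) / log 2 (real n * log 2 (real n) / real m)
     else real m / real n)"

definition linear_maps :: "(bit ^ 'u \<Rightarrow> bit ^ 'l) set" where
  "linear_maps = {h. Vector_Spaces.linear (*s) (*s) h}"

instance bit :: finite
proof
  have "(UNIV :: bit set) \<subseteq> {0, 1}"
    using bit.exhaust by blast
  then show "finite (UNIV :: bit set)"
    by (rule finite_subset) simp
qed

text \<open>
  Finiteness and nonemptiness make \<^const>\<open>pmf_of_set\<close> of this set the uniform distribution
  (it is unspecified for other sets).
\<close>

lemma finite_linear_maps: "finite (linear_maps :: (bit ^ 'u \<Rightarrow> bit ^ 'l) set)"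
  by (rule finite_subset[OF subset_UNIV]) simp

lemma linear_maps_nonempty: "(linear_maps :: (bit ^ 'u \<Rightarrow> bit ^ 'l) set) \<noteq> {}"
proof -
  have "(\<lambda>_. 0) \<in> (linear_maps :: (bit ^ 'u \<Rightarrow> bit ^ 'l) set)"
    unfolding linear_maps_def
    by (simp add: vec.linear_0 vec.linear_zero)
  then show ?thesis by blast
qed

end

theory Submission
  imports Defs
begin

text \<open>
  For \<open>b > 1\<close> let \<open>Z\<^sub>T(h) = \<Sum>\<^sub>y b ^ |h\<^sup>-\<^sup>1(y) \<inter> T|\<close>.  If a coordinate splits \<open>T\<close> into \<open>T\<^sub>0\<close> and \<open>T\<^sub>1\<close>,
  then adding to \<open>h\<close> the map sending \<open>x\<close> to \<open>x\<^sub>i a\<close> shifts the loads of \<open>T\<^sub>1\<close> by \<open>a\<close> and fixes those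
  of \<open>T\<^sub>0\<close>, so averaging over \<open>a\<close> turns \<open>Z\<^sub>T / n\<close> into \<open>(Z\<^bsub>T\<^sub>0\<^esub> / n) (Z\<^bsub>T\<^sub>1\<^esub> / n)\<close>.  By Jensen's
  inequality \<open>E ln (Z\<^sub>T / n)\<close> is subadditive along such splittings, and splitting down to singletons
  gives \<open>E ln (Z\<^sub>S / n) \<le> m (b - 1) / n\<close>.  As \<open>b\<close> to the power of the maximum load is at most
  \<open>Z\<^sub>S\<close>, the expected maximum load is at most \<open>(ln n + m (b - 1) / n) / ln b\<close>; choose
  \<open>b = n log n / m\<close> for small \<open>m\<close> and \<open>b = 2\<close> for large \<open>m\<close>.
\<close>

definition load :: "(bit ^ 'u) set \<Rightarrow> (bit ^ 'u \<Rightarrow> bit ^ 'l) \<Rightarrow> bit ^ 'l \<Rightarrow> nat" where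
  "load T h y = card (h -` {y} \<inter> T)"

definition load_gf :: "real \<Rightarrow> (bit ^ 'u) set \<Rightarrow> (bit ^ 'u \<Rightarrow> bit ^ 'l) \<Rightarrow> real" where
  "load_gf b T h = (\<Sum>y\<in>UNIV. b ^ load T h y)"

definition add_column :: "'u \<Rightarrow> bit ^ 'l \<Rightarrow> (bit ^ 'u \<Rightarrow> bit ^ 'l) \<Rightarrow> bit ^ 'u \<Rightarrow> bit ^ 'l" where
  "add_column i a h = (\<lambda>x. h x + x $ i *s a)"

lemma card_bit_vec: "CARD(bit ^ 'l::finite) = 2 ^ CARD('l)"
proof -
  have "(UNIV :: bit set) = {0, 1}"
    using bit.exhaust by blast
  then have "CARD(bit) = 2"
    by (metis card_2_iff zero_neq_one)
  then show ?thesis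
    by simp
qed

lemma bit_vec_add_self [simp]: "(x :: bit ^ 'l) + x = 0"
  by (simp add: vec_eq_iff)

lemma add_column_involution: "add_column i a (add_column i a h) = h"
  by (simp add: add_column_def fun_eq_iff add.assoc)

lemma add_column_linear:
  assumes "h \<in> linear_maps"
  shows "add_column i a h \<in> linear_maps"
proof -
  have "Vector_Spaces.linear (*s) (*s) (\<lambda>x :: bit ^ 'a. x $ i *s a)"
    by unfold_locales
      (simp_all only: vector_add_component vector_smult_component vec.scale_left_distrib vec.scale_scale)
  with assms show ?thesis
    unfolding linear_maps_def add_column_def by (auto intro: vec.linear_compose_add)
qed

text \<open>The uniform law on \<open>linear_maps\<close> is invariant under adding a fixed column,
  because that operation is an involution of the set. This is what permits averaging over the column
  \<open>a\<close>.\<close>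

lemma sum_linear_maps_add_column:
  "(\<Sum>h\<in>linear_maps. f (add_column i a h)) = (\<Sum>h\<in>linear_maps. f h)"
  by (rule sum.reindex_bij_witness[of _ "add_column i a" "add_column i a"])
    (simp_all add: add_column_linear add_column_involution)

lemma load_add_column:
  fixes T :: "(bit ^ 'u::finite) set"
  shows "load T (add_column i a h) y =
    load {x \<in> T. x $ i = 0} h y + load {x \<in> T. x $ i = 1} h (y + a)"
proof -
  \<comment> \<open>In characteristic 2, subtracting \<open>a\<close> is the same as adding
    it.\<close>
  have shift: "h x + a = y \<longleftrightarrow> h x = y + a" for x
    by (auto simp: add.assoc)
  have "add_column i a h -` {y} \<inter> T =
      (h -` {y} \<inter> {x \<in> T. x $ i = 0}) \<union> (h -` {y + a} \<inter> {x \<in> T. x $ i = 1})"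
    (is "_ = ?A \<union> ?B")
  proof (rule set_eqI)
    fix x
    show "x \<in> add_column i a h -` {y} \<inter> T \<longleftrightarrow> x \<in> ?A \<union> ?B"
      by (cases "x $ i") (auto simp: add_column_def shift)
  qed
  moreover have "?A \<inter> ?B = {}"
    by auto
  ultimately show ?thesis
    by (simp add: load_def card_Un_disjoint)
qed

text \<open>For fixed \<open>y\<close>, the point \<open>y + a\<close> runs over the whole space as
  \<open>a\<close> does, so the double sum over \<open>a\<close> and \<open>y\<close>
  factors.\<close>

lemma sum_load_gf_add_column:
  fixes T :: "(bit ^ 'u::finite) set" and h :: "bit ^ 'u \<Rightarrow> bit ^ 'l::finite"
  shows "(\<Sum>a\<in>UNIV. load_gf b T (add_column i a h)) =
    load_gf b {x \<in> T. x $ i = 0} h * load_gf b {x \<in> T. x $ i = 1} h"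
proof -
  let ?T0 = "{x \<in> T. x $ i = 0}" and ?T1 = "{x \<in> T. x $ i = 1}"
  have "(\<Sum>a\<in>UNIV. load_gf b T (add_column i a h)) =
      (\<Sum>a\<in>UNIV. \<Sum>y\<in>UNIV. b ^ load ?T0 h y * b ^ load ?T1 h (y + a))"
    by (simp add: load_gf_def load_add_column power_add)
  also have "\<dots> = (\<Sum>y\<in>UNIV. b ^ load ?T0 h y * (\<Sum>a\<in>UNIV. b ^ load ?T1 h (y + a)))"
    by (subst sum.swap) (simp add: sum_distrib_left)
  also have "\<dots> = (\<Sum>y\<in>UNIV. b ^ load ?T0 h y * load_gf b ?T1 h)"
  proof (intro sum.cong refl arg_cong2[where f = "(*)"])
    fix y
    show "(\<Sum>a\<in>UNIV. b ^ load ?T1 h (y + a)) = load_gf b ?T1 h"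
      unfolding load_gf_def
      by (rule sum.reindex_bij_witness[of _ "\<lambda>z. z - y" "\<lambda>a. y + a"]) simp_all
  qed
  finally show ?thesis
    by (simp add: load_gf_def sum_distrib_right)
qed

lemma load_gf_pos:
  assumes "b > 0"
  shows "load_gf b T (h :: bit ^ 'u::finite \<Rightarrow> bit ^ 'l::finite) > 0"
  unfolding load_gf_def using assms by (intro sum_pos) auto

lemma load_gf_empty: "load_gf b {} (h :: bit ^ 'u::finite \<Rightarrow> bit ^ 'l::finite) = 2 ^ CARD('l)"
  by (simp add: load_gf_def load_def card_bit_vec del: CARD_vec)

lemma load_gf_singleton:
  "load_gf b {x} (h :: bit ^ 'u::finite \<Rightarrow> bit ^ 'l::finite) = 2 ^ CARD('l) + (b - 1)"
proof -
  have "load_gf b {x} h = (\<Sum>y\<in>UNIV. 1 + (if y = h x then b - 1 else 0))"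
    unfolding load_gf_def load_def by (intro sum.cong) auto
  then show ?thesis
    by (simp add: sum.distrib card_bit_vec del: CARD_vec)
qed

text \<open>Jensen's inequality for \<open>ln\<close>, obtained from the tangent line at the mean
  \<open>c\<close>: the linear terms cancel on summation.\<close>

lemma sum_ln_le:
  fixes f :: "'a \<Rightarrow> real" and c :: real
  assumes "\<And>x. x \<in> A \<Longrightarrow> f x > 0" and "c > 0" and "sum f A = card A * c"
  shows "(\<Sum>x\<in>A. ln (f x)) \<le> card A * ln c"
proof -
  have "ln (f x) \<le> ln c + (f x / c - 1)" if "x \<in> A" for x
    using ln_le_minus_one[of "f x / c"] assms(1)[OF that] assms(2) by (simp add: ln_div)
  then have "(\<Sum>x\<in>A. ln (f x)) \<le> (\<Sum>x\<in>A. ln c + (f x / c - 1))"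
    by (rule sum_mono)
  also have "\<dots> = card A * ln c"
    using assms by (simp add: sum.distrib sum_subtractf flip: sum_divide_distrib)
  finally show ?thesis .
qed

text \<open>The \<open>itself\<close> argument fixes \<open>'l\<close>, which the type of
  \<open>T\<close> does not mention. Dividing by the number of values makes the empty set contribute
  0, as subadditivity without an error term requires.\<close>

definition log_gf_sum :: "'l::finite itself \<Rightarrow> real \<Rightarrow> (bit ^ 'u::finite) set \<Rightarrow> real" where
  "log_gf_sum _ b T =
    (\<Sum>h\<in>(linear_maps :: (bit ^ 'u \<Rightarrow> bit ^ 'l) set). ln (load_gf b T h / 2 ^ CARD('l)))"

lemma log_gf_sum_split:
  fixes T :: "(bit ^ 'u::finite) set" and b :: real
  assumes "b > 0"
  shows "log_gf_sum TYPE('l::finite) b T \<le>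
    log_gf_sum TYPE('l) b {x \<in> T. x $ i = 0} + log_gf_sum TYPE('l) b {x \<in> T. x $ i = 1}"
proof -
  let ?H = "linear_maps :: (bit ^ 'u \<Rightarrow> bit ^ 'l) set"
  let ?n = "2 ^ CARD('l) :: real"
  let ?T0 = "{x \<in> T. x $ i = 0}" and ?T1 = "{x \<in> T. x $ i = 1}"
  let ?F = "\<lambda>T (h :: bit ^ 'u \<Rightarrow> bit ^ 'l). load_gf b T h / ?n"
  have pos: "?F T h > 0" for T h
    by (simp add: load_gf_pos[OF assms])
  \<comment> \<open>By invariance each of the \<open>?n\<close> columns \<open>a\<close> gives the
    same inner sum over \<open>h\<close>.\<close>
  have "?n * log_gf_sum TYPE('l) b T =
      (\<Sum>a\<in>(UNIV :: (bit ^ 'l) set). \<Sum>h\<in>?H. ln (?F T (add_column i a h)))"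
    by (simp add: log_gf_sum_def card_bit_vec
        sum_linear_maps_add_column[where f = "\<lambda>h. ln (?F T h)"] del: CARD_vec)
  also have "\<dots> = (\<Sum>h\<in>?H. \<Sum>a\<in>UNIV. ln (?F T (add_column i a h)))"
    by (rule sum.swap)
  also have "\<dots> \<le> (\<Sum>h\<in>?H. ?n * (ln (?F ?T0 h) + ln (?F ?T1 h)))"
  proof (rule sum_mono)
    fix h
    have "(\<Sum>a\<in>UNIV. ln (?F T (add_column i a h))) \<le>
        real (CARD(bit ^ 'l)) * ln (?F ?T0 h * ?F ?T1 h)"
    proof (rule sum_ln_le)
      \<comment> \<open>The product of the two generating functions carries two normalising factors:
        one belongs to \<open>?F T\<close>, the other turns the sum over \<open>a\<close> into a
        mean.\<close>
      show "(\<Sum>a\<in>UNIV. ?F T (add_column i a h)) = real (CARD(bit ^ 'l)) * (?F ?T0 h * ?F ?T1 h)"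
        unfolding sum_divide_distrib[symmetric] sum_load_gf_add_column
        by (simp add: card_bit_vec del: CARD_vec)
    qed (intro mult_pos_pos pos)+
    then show "(\<Sum>a\<in>UNIV. ln (?F T (add_column i a h))) \<le> ?n * (ln (?F ?T0 h) + ln (?F ?T1 h))"
      using pos[of ?T0 h] pos[of ?T1 h] by (simp only: ln_mult_pos card_bit_vec) simp
  qed
  also have "\<dots> = ?n * (log_gf_sum TYPE('l) b ?T0 + log_gf_sum TYPE('l) b ?T1)"
    by (simp add: log_gf_sum_def sum.distrib sum_distrib_left distrib_left)
  finally show ?thesis
    by simp
qed

text \<open>The bound is additive in \<open>card T\<close>, so it passes through
  \<open>log_gf_sum_split\<close> by induction on proper subsets; only sets with at most one element
  need a direct estimate.\<close>

lemma log_gf_sum_le: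
  fixes T :: "(bit ^ 'u::finite) set" and b :: real
  assumes "b > 1"
  shows "log_gf_sum TYPE('l::finite) b T \<le>
    card (linear_maps :: (bit ^ 'u \<Rightarrow> bit ^ 'l) set) * (card T * (b - 1) / 2 ^ CARD('l))"
proof -
  let ?c = "(b - 1) / 2 ^ CARD('l)"
  let ?N = "card (linear_maps :: (bit ^ 'u \<Rightarrow> bit ^ 'l) set)"
  have "finite T"
    by simp
  then have "log_gf_sum TYPE('l) b T \<le> ?N * (card T * ?c)"
  proof (induction T rule: finite_psubset_induct)
    case (psubset T)
    consider "T = {}" | x where "T = {x}" | x x' where "x \<in> T" "x' \<in> T" "x \<noteq> x'"
      by blast
    then show ?case
    proof cases
      case 1
      then show ?thesis
        by (simp add: log_gf_sum_def load_gf_empty)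
    next
      case (2 x)
      have "ln (1 + ?c) \<le> ?c"
        using assms by (intro ln_add_one_self_le_self) simp
      then show ?thesis
        by (simp add: 2 log_gf_sum_def load_gf_singleton add_divide_distrib mult_left_mono
            del: times_divide_eq_right)
    next
      case (3 x x')
      then obtain i where i: "x $ i \<noteq> x' $ i"
        by (auto simp: vec_eq_iff)
      let ?T0 = "{x \<in> T. x $ i = 0}" and ?T1 = "{x \<in> T. x $ i = 1}"
      have un: "T = ?T0 \<union> ?T1"
        using bit.exhaust by blast
      \<comment> \<open>The points \<open>x\<close> and \<open>x'\<close> differ at
        \<open>i\<close>, so each half misses one of them.\<close>
      have "?T0 \<subset> T" "?T1 \<subset> T"
        using 3 i by (metis (mono_tags, lifting) mem_Collect_eq psubsetI subsetI)+
      then have ih: "log_gf_sum TYPE('l) b ?T0 \<le> ?N * (card ?T0 * ?c)"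
          "log_gf_sum TYPE('l) b ?T1 \<le> ?N * (card ?T1 * ?c)"
        by (simp_all only: psubset.IH)
      have "card T = card ?T0 + card ?T1"
        by (subst un, rule card_Un_disjoint) auto
      then have "?N * (card T * ?c) = ?N * (card ?T0 * ?c) + ?N * (card ?T1 * ?c)"
        by (simp only: of_nat_add distrib_left distrib_right)
      with ih log_gf_sum_split[of b T i, where 'l = 'l] assms show ?thesis
        by simp
    qed
  qed
  then show ?thesis
    by simp
qed

text \<open>The power of \<open>b\<close> at a fullest value is one of the nonnegative summands of
  \<open>load_gf\<close>; the term with \<open>ln 2\<close> undoes the normalisation.\<close>

lemma max_load_le:
  fixes h :: "bit ^ 'u::finite \<Rightarrow> bit ^ 'l::finite"
  assumes "b > 1"
  shows "real (MAX y\<in>UNIV. load S h y) * ln b \<le>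
    CARD('l) * ln 2 + ln (load_gf b S h / 2 ^ CARD('l))"
proof -
  have "(MAX y\<in>UNIV. load S h y) \<in> range (load S h)"
    by (rule Max_in) auto
  then obtain y where y: "(MAX y\<in>UNIV. load S h y) = load S h y"
    by blast
  have "b ^ load S h y \<le> load_gf b S h"
    unfolding load_gf_def using assms by (intro member_le_sum) auto
  then have "ln (b ^ load S h y) \<le> ln (load_gf b S h)"
    using assms by (subst ln_le_cancel_iff) (auto intro: load_gf_pos)
  moreover have "load_gf b S h > 0"
    using assms by (intro load_gf_pos) simp
  ultimately show ?thesis
    using assms by (simp add: y ln_div ln_realpow)
qed

lemma expectation_max_load_le:
  fixes S :: "(bit ^ 'u::finite) set" and b :: real
  assumes "b > 1"
  shows "measure_pmf.expectation (pmf_of_set (linear_maps :: (bit ^ 'u \<Rightarrow> bit ^ 'l::finite) set))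
      (\<lambda>h. real (MAX y\<in>UNIV. load S h y)) \<le>
    (CARD('l) * ln 2 + card S * (b - 1) / 2 ^ CARD('l)) / ln b"
proof -
  let ?H = "linear_maps :: (bit ^ 'u \<Rightarrow> bit ^ 'l) set"
  have N: "card ?H > 0"
    using finite_linear_maps linear_maps_nonempty by (auto simp: card_gt_0_iff)
  have "(\<Sum>h\<in>?H. real (MAX y\<in>UNIV. load S h y)) * ln b \<le>
      (\<Sum>h\<in>?H. CARD('l) * ln 2 + ln (load_gf b S h / 2 ^ CARD('l)))"
    unfolding sum_distrib_right by (intro sum_mono max_load_le assms)
  also have "\<dots> = card ?H * (CARD('l) * ln 2) + log_gf_sum TYPE('l) b S"
    by (simp add: sum.distrib log_gf_sum_def)
  also have "\<dots> \<le> card ?H * (CARD('l) * ln 2 + card S * (b - 1) / 2 ^ CARD('l))"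
    unfolding distrib_left using log_gf_sum_le[OF assms, of S, where 'l = 'l] by simp
  finally have "(\<Sum>h\<in>?H. real (MAX y\<in>UNIV. load S h y)) / card ?H \<le>
      (CARD('l) * ln 2 + card S * (b - 1) / 2 ^ CARD('l)) / ln b"
    using N assms by (simp add: pos_divide_le_eq pos_le_divide_eq mult.commute mult.left_commute)
  then show ?thesis
    by (simp add: integral_pmf_of_set finite_linear_maps linear_maps_nonempty)
qed

theorem theorem1p2:
  fixes S :: "(bit ^ 'u) set" and m n :: nat
  assumes "CARD('l::finite) \<le> CARD('u::finite)"
    and "1 \<le> m" and "m \<le> 2 ^ CARD('u)"
    and "n = 2 ^ CARD('l)"
    and "card S = m"
  shows "measure_pmf.expectation (pmf_of_set (linear_maps :: (bit ^ 'u \<Rightarrow> bit ^ 'l) set))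
           (\<lambda>h. real (MAX y\<in>UNIV. card (h -` {y} \<inter> S)))
         \<le> 16 * opt m n"
proof -
  let ?E = "measure_pmf.expectation (pmf_of_set (linear_maps :: (bit ^ 'u \<Rightarrow> bit ^ 'l) set))
           (\<lambda>h. real (MAX y\<in>UNIV. card (h -` {y} \<inter> S)))"
  define L where "L = real (CARD('l))"
  have L: "L > 0" "log 2 (real n) = L"
    using assms(4) by (auto simp: L_def log_nat_power)
  have m: "real m > 0" and n: "real n > 0"
    using assms by auto
  have bound: "?E \<le> (L * ln 2 + m * (b - 1) / n) / ln b" if "b > 1" for b :: real
    using expectation_max_load_le[OF that, of S, where 'l = 'l] assms(4,5)
    by (simp add: load_def L_def)
  have ln2: "ln 2 \<ge> (2 / 3 :: real)"
    by (rule ln2_ge_two_thirds)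
  show ?thesis
  proof (cases "real m \<le> 1 / 2 * real n * L")
    case True
    \<comment> \<open>With base \<open>R\<close>, the term \<open>m * (R - 1) / n\<close> is at most
      \<open>L\<close>, and \<open>ln R / ln 2\<close> is the denominator in \<open>opt\<close>. The
      case hypothesis says exactly that \<open>R\<close> is at least 2.\<close>
    define R where "R = n * L / m"
    have R: "R \<ge> 2"
      using True m by (simp add: R_def field_simps)
    then have lnR: "ln R > 0"
      by simp
    have "m * (R - 1) / n \<le> L"
      using m n by (simp add: R_def field_simps)
    \<comment> \<open>A generous estimate: 15 copies of \<open>L * ln 2\<close> join the one already
      in the numerator to make 16.\<close>
    also have "L \<le> L * (15 * ln 2)"
      using ln2 L by simp
    finally have "(L * ln 2 + m * (R - 1) / n) / ln R \<le> 16 * (L * ln 2) / ln R"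
      using lnR by (intro divide_right_mono) auto
    moreover have "opt m n = L / (ln R / ln 2)"
      using True by (simp add: opt_def L flip: R_def) (simp add: log_def)
    ultimately show ?thesis
      using bound[of R] R by simp
  next
    case False
    define r where "r = real m / real n"
    have "L < 2 * r"
      using False n by (simp add: r_def field_simps)
    moreover have r: "r > 0" "opt m n = r"
      using False m n by (auto simp: r_def opt_def L)
    moreover have "r / ln 2 \<le> r * (3 / 2)"
      using ln2 r by (simp add: field_simps)
    \<comment> \<open>Base 2 suffices here: the total is at most \<open>2 * r + 3 / 2 * r\<close>,
      well below \<open>16 * r\<close>.\<close>
    moreover have "?E \<le> L + r / ln 2"
      using bound[of 2] by (simp add: r_def add_divide_distrib)
    ultimately show ?thesis
      by linarith
  qed
qed

end
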